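(* Let $(S,+)$ be a countable commutative semigroup and let $A\subseteq S$ be piecewise syndetic in $S$. Then for every $l\in\mathbb{N}$ there exists $d\in\mathbb{N}$ such that \[ \{(s,t)\in S\times S:\{s,\,s+dt,\,s+2dt,\ldots,s+ldt\}\subseteq A\} \] is piecewise syndetic in $S\times S$.
   Context: $\mathbb{N}=\{1,2,3,\ldots\}$. For $n\in\mathbb{N}$ and $t\in S$, $nt$ denotes $t+t+\cdots+t$ ($n$ summands). $S\times S$ carries the coordinatewise operation. For a commutative semigroup $(T,+)$, $x\in T$ and $A\subseteq T$, write $-x+A=\{y\in T: x+y\in A\}$. A set $A\subseteq T$ is thick if for every finite $H\subseteq T$ there is $x\in T$ with $H+x\subseteq A$. A set $A\subseteq T$ is piecewise syndetic if there is a finite set $F\subseteq T$ such that $\bigcup_{x\in F}(-x+A)$ is thick. *)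

theory Defs
  imports "HOL-Library.Countable_Set" "HOL-Library.Product_Plus"
begin

text \<open>A semigroup need not have a zero, so \<open>multiple n t\<close> is the sum of \<open>n\<close> copies of \<open>t\<close>
  only for \<open>n \<ge> 1\<close>; the value at \<open>n = 0\<close> is junk.\<close>

definition multiple :: "nat \<Rightarrow> 'a::ab_semigroup_add \<Rightarrow> 'a" where
  "multiple n t = ((+) t ^^ (n - 1)) t"

lemma multiple_1: "multiple 1 t = t"
  by (simp add: multiple_def)

lemma multiple_Suc: "n \<ge> 1 \<Longrightarrow> multiple (Suc n) t = t + multiple n t"
  by (cases n) (simp_all add: multiple_def)

definition translate_vimage :: "'a::ab_semigroup_add \<Rightarrow> 'a set \<Rightarrow> 'a set" where
  "translate_vimage x A = {y. x + y \<in> A}"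

definition thick :: "'a::ab_semigroup_add set \<Rightarrow> bool" where
  "thick A \<longleftrightarrow> (\<forall>H. finite H \<longrightarrow> (\<exists>x. (\<lambda>h. h + x) ` H \<subseteq> A))"

definition piecewise_syndetic :: "'a::ab_semigroup_add set \<Rightarrow> bool" where
  "piecewise_syndetic A \<longleftrightarrow> (\<exists>F. finite F \<and> thick (\<Union>x\<in>F. translate_vimage x A))"

end

theory Submission imports Defs begin

text \<open>Let \<open>T = \<Union>x\<in>F. -x + A\<close> be thick with \<open>F\<close> finite, and colour \<open>y \<in> T\<close> by some
  \<open>x \<in> F\<close> with \<open>x + y \<in> A\<close>. For every \<open>N\<close> the set of pairs \<open>(s, t)\<close> with \<open>s + j t \<in> T\<close>
  for \<open>1 \<le> j < N\<close> is thick in \<open>S \<times> S\<close>. If \<open>N\<close> is a van der Waerden number for the colours \<open>F\<close>,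
  every such pair admits \<open>x \<in> F\<close>, \<open>j\<close> and \<open>d\<close> with \<open>x + s + j t + k d t \<in> A\<close> for all \<open>k \<le> l\<close>.
  There are finitely many triples \<open>(x, j, d)\<close>, so by partition regularity one of them occurs on a
  piecewise syndetic set of pairs. That \<open>d\<close> works: the endomorphism \<open>(s, t) \<mapsto> (s + j t, t)\<close>
  reaches a translate of every finite set, and this suffices to push piecewise syndeticity
  forward.\<close>

section \<open>Van der Waerden's theorem\<close>

text \<open>The start \<open>a\<close> carries no colour condition, so only positions at least 1
  matter. This avoids the junk value of \<open>multiple\<close> at 0 and leaves \<open>a\<close> as
  a base for the new focus.\<close>

definition monochromatic_ap :: "nat \<Rightarrow> nat \<Rightarrow> (nat \<Rightarrow> 'b) \<Rightarrow> bool" where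
  "monochromatic_ap l N c \<longleftrightarrow>
    (\<exists>a e. e \<ge> 1 \<and> a + l * e < N \<and> (\<forall>k\<in>{1..l}. c (a + k * e) = c (a + e)))"

definition vdw_number :: "nat \<Rightarrow> nat \<Rightarrow> nat \<Rightarrow> bool" where
  "vdw_number l r N \<longleftrightarrow> (\<forall>c. (\<forall>j. c j < r) \<longrightarrow> monochromatic_ap l N c)"

lemma vdw_number_finite_colours:
  assumes "finite C" "vdw_number l (card C) N" "l \<ge> 1" "\<And>j. c j \<in> C"
  shows "monochromatic_ap l N c"
proof -
  obtain f :: "_ \<Rightarrow> nat" where "bij_betw f C {0..<card C}"
    using ex_bij_betw_finite_nat[OF assms(1)] by blast
  then have f: "f ` C = {0..<card C}" "inj_on f C" by (auto simp: bij_betw_def)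
  then have "\<forall>j. f (c j) < card C" using assms(4) by force
  then have "monochromatic_ap l N (\<lambda>j. f (c j))"
    using assms(2)[unfolded vdw_number_def, rule_format, of "\<lambda>j. f (c j)"] by blast
  then obtain a e where "e \<ge> 1" "a + l * e < N" "\<forall>k\<in>{1..l}. f (c (a + k * e)) = f (c (a + e))"
    unfolding monochromatic_ap_def by blast
  moreover from this have "\<forall>k\<in>{1..l}. c (a + k * e) = c (a + e)"
    using inj_onD[OF f(2) _ assms(4) assms(4)] by blast
  ultimately show ?thesis unfolding monochromatic_ap_def by blast
qed

text \<open>Counting the start, this has one term more than \<open>monochromatic_ap\<close> for the
  same \<open>l\<close>; that extra term drives the induction on \<open>l\<close>.\<close>

definition full_ap :: "nat \<Rightarrow> nat \<Rightarrow> (nat \<Rightarrow> 'b) \<Rightarrow> bool" where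
  "full_ap l N c \<longleftrightarrow> (\<exists>a e. e \<ge> 1 \<and> a + l * e < N \<and> (\<forall>k\<in>{1..l}. c (a + k * e) = c a))"

text \<open>These are the spokes of the classical colour-focusing proof. No colour is prescribed at
  \<open>f\<close>, so a spoke that happens to share the colour of \<open>f\<close> becomes a
  \<open>full_ap\<close>.\<close>

definition focused :: "nat \<Rightarrow> nat \<Rightarrow> (nat \<Rightarrow> 'b) \<Rightarrow> nat \<Rightarrow> 'b set \<Rightarrow> bool" where
  "focused l N c f X \<longleftrightarrow>
    (\<forall>x\<in>X. \<exists>e\<ge>1. f + l * e < N \<and> (\<forall>k\<in>{1..l}. c (f + k * e) = x))"

lemma full_ap_shift:
  assumes "full_ap l N (\<lambda>j. c (b + j))" "b + N \<le> N'"
  shows "full_ap l N' c"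
proof -
  obtain a e where ae: "e \<ge> 1" "a + l * e < N" "\<forall>k\<in>{1..l}. c (b + (a + k * e)) = c (b + a)"
    using assms(1) unfolding full_ap_def by blast
  show ?thesis unfolding full_ap_def
  proof (intro exI conjI)
    show "\<forall>k\<in>{1..l}. c ((b + a) + k * e) = c (b + a)" using ae(3) by (simp add: add.assoc)
    show "b + a + l * e < N'" using ae(2) assms(2) by linarith
  qed (use ae in auto)
qed

text \<open>Colour focusing. The blocks of length \<open>N\<close> starting at \<open>a + e\<close>, \<dots>, \<open>a + l e\<close> look the same,
  so the spokes around \<open>f\<close> in the first of them give spokes around \<open>a + f\<close> with the differences
  increased by \<open>e\<close>, and \<open>e\<close> itself is the difference of a further spoke.\<close>

lemma colour_focusing:
  fixes l r m :: nat
  assumes l: "l \<ge> 1" and vdw: "\<And>r. \<exists>N. vdw_number l r N"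
  shows "\<exists>N. \<forall>c. (\<forall>j. c j < r) \<longrightarrow>
    full_ap l N c \<or> (\<exists>f<N. \<exists>X\<subseteq>{..<r}. card X = m \<and> focused l N c f X)"
proof (induction m)
  case 0
  show ?case by (rule exI[of _ 1]) (auto simp: focused_def intro!: exI[of _ "{}"])
next
  case (Suc m)
  then obtain N where N: "\<And>c. \<forall>j. c j < r \<Longrightarrow>
      full_ap l N c \<or> (\<exists>f<N. \<exists>X\<subseteq>{..<r}. card X = m \<and> focused l N c f X)" by blast
  \<comment> \<open>The colour of a block is the word of length \<open>N\<close> that it carries, so
    finitely many colours suffice.\<close>
  define C where "C = {xs. set xs \<subseteq> {..<r} \<and> length xs = N}"
  have "finite C" unfolding C_def by (rule finite_lists_length_eq) simp
  obtain N' where N': "vdw_number l (card C) N'" using vdw by blast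
  show ?case
  proof (intro exI[of _ "N' + N"] allI impI)
    fix c :: "nat \<Rightarrow> nat" assume c: "\<forall>j. c j < r"
    define block where "block j = map (\<lambda>i. c (j + i)) [0..<N]" for j
    have "block j \<in> C" for j using c by (auto simp: C_def block_def)
    then have "monochromatic_ap l N' block"
      using vdw_number_finite_colours[OF \<open>finite C\<close> N' l] by blast
    then obtain a e where e: "e \<ge> 1" and bound: "a + l * e < N'"
      and "\<forall>k\<in>{1..l}. block (a + k * e) = block (a + e)"
      unfolding monochromatic_ap_def by blast
    then have same: "c (a + k * e + i) = c (a + e + i)" if "k \<in> {1..l}" "i < N" for k i
      using that by (simp add: block_def)
    have "e \<le> l * e" using l by simp
    then have ae: "a + e + N \<le> N' + N" using bound by linarith
    consider "full_ap l N (\<lambda>j. c (a + e + j))"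
      | f X where "f < N" "X \<subseteq> {..<r}" "card X = m" "focused l N (\<lambda>j. c (a + e + j)) f X"
      using N[of "\<lambda>j. c (a + e + j)"] c by blast
    then show "full_ap l (N' + N) c \<or>
      (\<exists>f<N' + N. \<exists>X\<subseteq>{..<r}. card X = Suc m \<and> focused l (N' + N) c f X)"
    proof cases
      case 1
      then show ?thesis using full_ap_shift ae by blast
    next
      case 2
      let ?x = "c (a + e + f)"
      show ?thesis
      \<comment> \<open>A spoke in the colour of the focus completes a \<open>full_ap\<close>;
        otherwise that colour is new and gives one more spoke.\<close>
      proof (cases "?x \<in> X")
        case True
        then obtain e' where "e' \<ge> 1" "f + l * e' < N" "\<forall>k\<in>{1..l}. c (a + e + (f + k * e')) = ?x"
          using 2(4) unfolding focused_def by blast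
        then have "full_ap l N (\<lambda>j. c (a + e + j))" unfolding full_ap_def by blast
        then show ?thesis using full_ap_shift ae by blast
      next
        case False
        have "focused l (N' + N) c (a + f) (insert ?x X)"
          unfolding focused_def
        proof (rule ballI)
          fix x assume "x \<in> insert ?x X"
          then consider "x = ?x" | "x \<in> X" by blast
          then show "\<exists>e\<ge>1. a + f + l * e < N' + N \<and> (\<forall>k\<in>{1..l}. c (a + f + k * e) = x)"
          proof cases
            case 1
            have "c (a + f + k * e) = x" if "k \<in> {1..l}" for k
              using same[OF that 2(1)] 1 by (simp add: ac_simps)
            moreover have "a + f + l * e < N' + N" using bound 2(1) by linarith
            ultimately show ?thesis using e by blast
          next
            case x: 2
            then obtain e' where e': "e' \<ge> 1" "f + l * e' < N"
              "\<forall>k\<in>{1..l}. c (a + e + (f + k * e')) = x"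
              using 2(4) unfolding focused_def by blast
            \<comment> \<open>Term \<open>k\<close> of the old spoke is read in block
              \<open>k\<close> instead of the first block.\<close>
            have "c (a + f + k * (e + e')) = x" if k: "k \<in> {1..l}" for k
            proof -
              have "k * e' \<le> l * e'" using k by simp
              then have "f + k * e' < N" using e'(2) by linarith
              from same[OF k this] have "c (a + k * e + (f + k * e')) = x" using e'(3) k by simp
              then show ?thesis by (simp add: algebra_simps)
            qed
            moreover have "a + f + l * (e + e') < N' + N"
              using bound e'(2) by (simp add: algebra_simps)
            ultimately show ?thesis using e by (intro exI[of _ "e + e'"]) auto
          qed
        qed
        moreover have "a + f < N' + N" using ae 2(1) by linarith
        moreover have "insert ?x X \<subseteq> {..<r}" using c 2(2) by auto
        moreover have "card (insert ?x X) = Suc m"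
          using False 2 by (meson card_insert_disjoint finite_lessThan finite_subset)
        ultimately show ?thesis by blast
      qed
    qed
  qed
qed

text \<open>\<open>r\<close> stays arbitrary in the induction because colouring blocks changes the
  number of colours. With \<open>r\<close> spokes all colours occur, so one spoke agrees with its
  focus.\<close>

theorem van_der_Waerden:
  assumes "l \<ge> 1"
  shows "\<exists>N. vdw_number l r N"
  using assms
proof (induction l arbitrary: r rule: dec_induct)
  case base
  have "monochromatic_ap 1 2 c" for c :: "nat \<Rightarrow> nat"
    unfolding monochromatic_ap_def by (intro exI[of _ 0] exI[of _ 1]) auto
  then show ?case unfolding vdw_number_def by blast
next
  case (step l)
  obtain N where N: "\<And>c. \<forall>j. c j < r \<Longrightarrow>
      full_ap l N c \<or> (\<exists>f<N. \<exists>X\<subseteq>{..<r}. card X = r \<and> focused l N c f X)"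
    using colour_focusing[OF step(1) step(3), of r r] by blast
  have full: "full_ap l N c" if c: "\<forall>j. c j < r" for c
    using N[OF c]
  proof (elim disjE exE conjE)
    fix f X assume "X \<subseteq> {..<r}" "card X = r" "focused l N c f X"
    moreover from this have "c f \<in> X" using c card_subset_eq[of "{..<r}" X] by simp
    ultimately have "\<exists>e\<ge>1. f + l * e < N \<and> (\<forall>k\<in>{1..l}. c (f + k * e) = c f)"
      unfolding focused_def by simp
    then show ?thesis unfolding full_ap_def by blast
  qed
  \<comment> \<open>A \<open>full_ap\<close> is sought in the window from \<open>N\<close> on, so
    that stepping back by \<open>e \<le> N\<close> stays in the naturals and supplies the uncoloured
    start.\<close>
  have "monochromatic_ap (Suc l) (N + N) c" if c: "\<forall>j. c j < r" for c
  proof -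
    have "full_ap l N (\<lambda>j. c (N + j))" using full[of "\<lambda>j. c (N + j)"] c by simp
    then obtain a e where ae: "e \<ge> 1" "a + l * e < N"
      "\<forall>k\<in>{1..l}. c (N + (a + k * e)) = c (N + a)"
      unfolding full_ap_def by blast
    have "e \<le> l * e" using step(1) by simp
    then have "e \<le> N" using ae(2) by linarith
    then have shift: "N + a - e + Suc k * e = N + (a + k * e)" for k by simp
    have "c (N + a - e + k * e) = c (N + a - e + e)" if "k \<in> {1..Suc l}" for k
    proof (cases k)
      case (Suc k')
      then show ?thesis
        using that ae(3) shift[of k'] shift[of 0] by (cases "k' = 0") auto
    qed (use that in auto)
    moreover have "N + a - e + Suc l * e < N + N" unfolding shift using ae(2) by simp
    ultimately show ?thesis unfolding monochromatic_ap_def using ae(1) by blast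
  qed
  then show ?case unfolding vdw_number_def by blast
qed

section \<open>Piecewise syndetic sets\<close>

lemma thickD:
  assumes "thick A" "finite H"
  obtains x where "\<And>h. h \<in> H \<Longrightarrow> h + x \<in> A"
proof -
  from assms obtain x where "(\<lambda>h. h + x) ` H \<subseteq> A" unfolding thick_def by blast
  then show thesis using that[of x] by blast
qed

lemma thick_imp_piecewise_syndetic:
  fixes A :: "'a::ab_semigroup_add set"
  assumes "thick A"
  shows "piecewise_syndetic A"
proof -
  \<comment> \<open>There need not be a zero to serve as trivial translation; an arbitrary
    \<open>f\<close> works, as thickness is applied to \<open>f + H\<close>.\<close>
  fix f :: 'a
  have "thick (\<Union>x\<in>{f}. translate_vimage x A)"
    unfolding thick_def
  proof (intro allI impI)
    fix H :: "'a set" assume "finite H"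
    then have "finite ((+) f ` H)" by simp
    then obtain x where "\<And>h. h \<in> (+) f ` H \<Longrightarrow> h + x \<in> A" using thickD[OF assms] by blast
    then have "f + h + x \<in> A" if "h \<in> H" for h using that by blast
    then show "\<exists>x. (\<lambda>h. h + x) ` H \<subseteq> (\<Union>x\<in>{f}. translate_vimage x A)"
      by (intro exI[of _ x]) (auto simp: translate_vimage_def add.assoc)
  qed
  then show ?thesis unfolding piecewise_syndetic_def by blast
qed

text \<open>If \<open>H\<close> witnesses that \<open>Q\<close> is not thick, each translate of
  \<open>H\<close> has a point outside \<open>Q\<close>. When the translate lies in
  \<open>P \<union> Q\<close>, that point is in \<open>P\<close>, so \<open>H\<close> itself serves
  as the finite set of shifts for \<open>P\<close>.\<close>

lemma thick_Un_imp_piecewise_syndetic: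
  fixes P Q :: "'a::ab_semigroup_add set"
  assumes "thick (P \<union> Q)" "\<not> thick Q"
  shows "piecewise_syndetic P"
proof -
  obtain H where H: "finite H" "\<And>x. \<exists>h\<in>H. h + x \<notin> Q"
    using assms(2) unfolding thick_def by blast
  have "thick (\<Union>h\<in>H. translate_vimage h P)"
    unfolding thick_def
  proof (intro allI impI)
    fix K :: "'a set" assume "finite K"
    then have "finite ((\<lambda>(h, k). h + k) ` (H \<times> K))" using H(1) by simp
    then obtain x where
      x: "\<And>g. g \<in> (\<lambda>(h, k). h + k) ` (H \<times> K) \<Longrightarrow> g + x \<in> P \<union> Q"
      using thickD[OF assms(1)] by blast
    have "k + x \<in> (\<Union>h\<in>H. translate_vimage h P)" if "k \<in> K" for k
    proof -
      obtain h where "h \<in> H" "h + (k + x) \<notin> Q" using H(2) by blast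
      moreover have "h + k + x \<in> P \<union> Q" using x \<open>h \<in> H\<close> that by blast
      ultimately show ?thesis by (auto simp: translate_vimage_def add.assoc)
    qed
    then show "\<exists>x. (\<lambda>h. h + x) ` K \<subseteq> (\<Union>h\<in>H. translate_vimage h P)" by blast
  qed
  then show ?thesis using H(1) unfolding piecewise_syndetic_def by blast
qed

text \<open>Shifting by \<open>x\<close> and then by \<open>g\<close> is shifting by
  \<open>x + g\<close>, so the sumset of \<open>F\<close> and \<open>G\<close> is the required
  finite set.\<close>

lemma piecewise_syndetic_translates:
  fixes B :: "'a::ab_semigroup_add set"
  assumes "finite F" "piecewise_syndetic (\<Union>x\<in>F. translate_vimage x B)"
  shows "piecewise_syndetic B"
proof -
  obtain G where G: "finite G" "thick (\<Union>g\<in>G. translate_vimage g (\<Union>x\<in>F. translate_vimage x B))"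
    using assms(2) unfolding piecewise_syndetic_def by blast
  have "(\<Union>g\<in>G. translate_vimage g (\<Union>x\<in>F. translate_vimage x B)) =
      (\<Union>z\<in>(\<lambda>(x, g). x + g) ` (F \<times> G). translate_vimage z B)"
    by (auto simp: translate_vimage_def add.assoc) blast
  then have "thick (\<Union>z\<in>(\<lambda>(x, g). x + g) ` (F \<times> G). translate_vimage z B)"
    using G(2) by simp
  moreover have "finite ((\<lambda>(x, g). x + g) ` (F \<times> G))" using G(1) assms(1) by simp
  ultimately show ?thesis unfolding piecewise_syndetic_def by blast
qed

text \<open>Partition regularity: either the translates of \<open>C\<close> already have a thick
  union, or the previous criterion applies to those of \<open>B\<close>.\<close>

lemma piecewise_syndetic_Un:
  assumes "piecewise_syndetic (B \<union> C)"
  shows "piecewise_syndetic B \<or> piecewise_syndetic C"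
proof -
  obtain F where F: "finite F" "thick (\<Union>x\<in>F. translate_vimage x (B \<union> C))"
    using assms unfolding piecewise_syndetic_def by blast
  have "(\<Union>x\<in>F. translate_vimage x (B \<union> C)) =
      (\<Union>x\<in>F. translate_vimage x B) \<union> (\<Union>x\<in>F. translate_vimage x C)"
    by (auto simp: translate_vimage_def)
  then have "thick ((\<Union>x\<in>F. translate_vimage x B) \<union> (\<Union>x\<in>F. translate_vimage x C))"
    using F(2) by simp
  from thick_Un_imp_piecewise_syndetic[OF this]
  have "piecewise_syndetic (\<Union>x\<in>F. translate_vimage x B) \<or>
      piecewise_syndetic (\<Union>x\<in>F. translate_vimage x C)"
    using thick_imp_piecewise_syndetic[of "\<Union>x\<in>F. translate_vimage x C"] by argo
  then show ?thesis
    using piecewise_syndetic_translates[OF F(1), of B] piecewise_syndetic_translates[OF F(1), of C]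
    by argo
qed

lemma not_piecewise_syndetic_empty: "\<not> piecewise_syndetic {}"
proof
  assume "piecewise_syndetic ({} :: 'a set)"
  then have "thick ({} :: 'a set)"
    by (simp add: piecewise_syndetic_def translate_vimage_def)
  then obtain x :: 'a where "\<And>h. h \<in> {undefined} \<Longrightarrow> h + x \<in> {}"
    using thickD[of "{}" "{undefined}"] by blast
  then show False by blast
qed

lemma piecewise_syndetic_UN:
  assumes "finite I" "piecewise_syndetic (\<Union>i\<in>I. B i)"
  shows "\<exists>i\<in>I. piecewise_syndetic (B i)"
  using assms
proof (induction I rule: finite_induct)
  case empty
  then show ?case by (simp add: not_piecewise_syndetic_empty)
next
  case (insert i I)
  then show ?case using piecewise_syndetic_Un[of "B i" "\<Union>i\<in>I. B i"] by auto
qed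

lemma piecewise_syndetic_mono:
  assumes "piecewise_syndetic B" "B \<subseteq> C"
  shows "piecewise_syndetic C"
proof -
  obtain F where F: "finite F" "thick (\<Union>x\<in>F. translate_vimage x B)"
    using assms unfolding piecewise_syndetic_def by blast
  have "(\<Union>x\<in>F. translate_vimage x B) \<subseteq> (\<Union>x\<in>F. translate_vimage x C)"
    using assms(2) by (auto simp: translate_vimage_def)
  then have "thick (\<Union>x\<in>F. translate_vimage x C)"
    using F(2) unfolding thick_def by (meson order_trans)
  then show ?thesis using F(1) unfolding piecewise_syndetic_def by blast
qed

section \<open>Arithmetic progressions in a semigroup\<close>

lemma multiple_add:
  assumes "m \<ge> 1" "n \<ge> 1"
  shows "multiple (m + n) t = multiple m t + multiple n t"
  using assms(1)
proof (induction m rule: dec_induct)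
  case base
  then show ?case using multiple_Suc[OF assms(2)] multiple_1[of t] by simp
next
  case (step m)
  then show ?case using assms(2) by (simp add: multiple_Suc add.assoc)
qed

lemma multiple_distrib:
  assumes "n \<ge> 1"
  shows "multiple n (s + t) = multiple n s + multiple n t"
  using assms
proof (induction n rule: dec_induct)
  case base
  then show ?case by (metis multiple_1)
next
  case (step n)
  then show ?case by (simp add: multiple_Suc ac_simps)
qed

text \<open>\<open>M\<close> is an arbitrary element plus all the \<open>f h\<close>. The arbitrary
  summand keeps the complement \<open>z\<close> available without a zero, even for a
  singleton.\<close>

lemma finite_common_sum:
  fixes f :: "'b \<Rightarrow> 'a::ab_semigroup_add"
  assumes "finite H"
  shows "\<exists>M. \<forall>h\<in>H. \<exists>z. z + f h = M"
  using assms
proof (induction H rule: finite_induct)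
  case (insert h H)
  then obtain M where M: "\<forall>h\<in>H. \<exists>z. z + f h = M" by blast
  have "\<exists>z. z + f g = M + f h" if "g \<in> insert h H" for g
  proof (cases "g = h")
    case False
    then have "g \<in> H" using that by simp
    then obtain z where "z + f g = M" using M by blast
    then have "(z + f h) + f g = M + f h" by (metis add.assoc add.commute)
    then show ?thesis by (rule exI)
  next
    case True
    then show ?thesis by auto
  qed
  then show ?case by blast
qed simp

text \<open>The shear moves each \<open>h\<close> by its own \<open>multiple j (snd h)\<close>.
  Adding \<open>z h\<close> to the first coordinate beforehand turns all these shifts into the
  common \<open>M\<close>, so the image contains a translate of \<open>H\<close>.\<close>

lemma piecewise_syndetic_shear:
  fixes B :: "('a::ab_semigroup_add \<times> 'a) set"
  assumes j: "j \<ge> 1" and ps: "piecewise_syndetic {(s, t). (a + s + multiple j t, t) \<in> B}"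
  shows "piecewise_syndetic B"
proof -
  define Q where "Q = {(s, t). (a + s + multiple j t, t) \<in> B}"
  obtain G where G: "finite G" "thick (\<Union>g\<in>G. translate_vimage g Q)"
    using ps unfolding Q_def piecewise_syndetic_def by blast
  define \<phi> where "\<phi> g = (a + fst g + multiple j (snd g), snd g)" for g :: "'a \<times> 'a"
  have "thick (\<Union>g\<in>\<phi> ` G. translate_vimage g B)"
    unfolding thick_def
  proof (intro allI impI)
    fix H :: "('a \<times> 'a) set" assume "finite H"
    then obtain M where "\<forall>h\<in>H. \<exists>z. z + multiple j (snd h) = M"
      using finite_common_sum[of H "\<lambda>h. multiple j (snd h)"] by blast
    then obtain z where z: "\<And>h. h \<in> H \<Longrightarrow> z h + multiple j (snd h) = M" by metis
    have "finite ((\<lambda>h. (fst h + z h, snd h)) ` H)" using \<open>finite H\<close> by simp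
    then obtain w where w: "\<And>h. h \<in> (\<lambda>h. (fst h + z h, snd h)) ` H \<Longrightarrow>
        h + w \<in> (\<Union>g\<in>G. translate_vimage g Q)"
      using thickD[OF G(2)] by blast
    obtain x y where xy: "w = (x, y)" by force
    have "h + (M + x + multiple j y, y) \<in> (\<Union>g\<in>\<phi> ` G. translate_vimage g B)" if h: "h \<in> H" for h
    proof -
      obtain h1 h2 where hh: "h = (h1, h2)" by force
      obtain g where g: "g \<in> G" "g + ((fst h + z h, snd h) + w) \<in> Q"
        using w h unfolding translate_vimage_def by blast
      obtain g1 g2 where gg: "g = (g1, g2)" by force
      have "(a + (g1 + (h1 + z h + x)) + multiple j (g2 + (h2 + y)), g2 + (h2 + y)) \<in> B"
        using g(2) unfolding Q_def gg hh xy by simp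
      moreover have "a + (g1 + (h1 + z h + x)) + multiple j (g2 + (h2 + y)) =
          (a + g1 + multiple j g2) + (h1 + ((z h + multiple j h2) + x + multiple j y))"
        using j by (simp add: multiple_distrib ac_simps)
      moreover have "z h + multiple j h2 = M" using z[OF h] hh by simp
      ultimately have "\<phi> g + (h + (M + x + multiple j y, y)) \<in> B"
        unfolding \<phi>_def gg hh by simp
      then show ?thesis using g(1) unfolding translate_vimage_def by blast
    qed
    then show "\<exists>x. (\<lambda>h. h + x) ` H \<subseteq> (\<Union>g\<in>\<phi> ` G. translate_vimage g B)" by blast
  qed
  then show ?thesis using G(1) unfolding piecewise_syndetic_def by blast
qed

lemma thick_progressions:
  fixes T :: "'a::ab_semigroup_add set"
  assumes "thick T"
  shows "thick {(s, t). \<forall>j\<in>{1..<N}. s + multiple j t \<in> T}"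
  unfolding thick_def
proof (intro allI impI)
  fix H :: "('a \<times> 'a) set" assume "finite H"
  \<comment> \<open>The second shift \<open>y\<close> is fixed first; then only finitely many
    elements remain to be moved into \<open>T\<close> by \<open>x\<close>.\<close>
  fix y :: 'a
  have "finite ((\<lambda>(h, j). fst h + multiple j (snd h + y)) ` (H \<times> {1..<N}))"
    using \<open>finite H\<close> by simp
  then obtain x where x: "\<And>g. g \<in> (\<lambda>(h, j). fst h + multiple j (snd h + y)) ` (H \<times> {1..<N})
      \<Longrightarrow> g + x \<in> T"
    using thickD[OF assms] by blast
  have "fst h + x + multiple j (snd h + y) \<in> T" if "h \<in> H" "j \<in> {1..<N}" for h j
  proof -
    have "fst h + multiple j (snd h + y) + x \<in> T" using x that by blast
    then show ?thesis by (simp add: ac_simps)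
  qed
  then have "\<forall>j\<in>{1..<N}. fst h + x + multiple j (snd h + y) \<in> T" if "h \<in> H" for h
    using that by blast
  then have "h + (x, y) \<in> {(s, t). \<forall>j\<in>{1..<N}. s + multiple j t \<in> T}" if "h \<in> H" for h
    using that by (simp add: case_prod_beta)
  then show "\<exists>x. (\<lambda>h. h + x) ` H \<subseteq> {(s, t). \<forall>j\<in>{1..<N}. s + multiple j t \<in> T}"
    by (meson image_subsetI)
qed

theorem theorem7:
  fixes A :: "'a::ab_semigroup_add set" and l :: nat
  assumes "countable (UNIV :: 'a set)"
    and "piecewise_syndetic A"
    and "l \<ge> 1"
  shows "\<exists>d::nat. d \<ge> 1 \<and>
    piecewise_syndetic
      {(s, t). insert s ((\<lambda>k. s + multiple (k * d) t) ` {1..l}) \<subseteq> A}"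
proof -
  obtain F where F: "finite F" and thick: "thick (\<Union>x\<in>F. translate_vimage x A)"
    using assms(2) unfolding piecewise_syndetic_def by blast
  define T where "T = (\<Union>x\<in>F. translate_vimage x A)"
  have "F \<noteq> {}"
    using thick_imp_piecewise_syndetic[OF thick] not_piecewise_syndetic_empty by auto
  then obtain x0 where x0: "x0 \<in> F" by blast
  \<comment> \<open>\<open>Suc l\<close> terms are needed: the first becomes the new
    \<open>s\<close>, the other \<open>l\<close> its successors.\<close>
  obtain N where N: "vdw_number (Suc l) (card F) N" using van_der_Waerden[of "Suc l"] by auto
  define B where "B d = {(s, t). insert s ((\<lambda>k. s + multiple (k * d) t) ` {1..l}) \<subseteq> A}" for d
  define Q where "Q = (\<lambda>(x, j, d). {(s, t). (x + s + multiple j t, t) \<in> B d})"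
  have "(s, t) \<in> (\<Union>i\<in>F \<times> {1..<N} \<times> {1..<N}. Q i)"
    if st: "\<forall>j\<in>{1..<N}. s + multiple j t \<in> T" for s t
  proof -
    \<comment> \<open>The colouring must be total with values in \<open>F\<close>; outside the range
      \<open>x0\<close> is a default.\<close>
    have "\<exists>x\<in>F. j \<in> {1..<N} \<longrightarrow> x + (s + multiple j t) \<in> A" for j
      using st x0 unfolding T_def translate_vimage_def by blast
    then obtain c where cF: "\<And>j. c j \<in> F"
      and c: "\<And>j. j \<in> {1..<N} \<Longrightarrow> c j + (s + multiple j t) \<in> A" by metis
    have "monochromatic_ap (Suc l) N c"
      using vdw_number_finite_colours[OF F N _ cF] by simp
    then obtain a d where d: "d \<ge> 1" and bound: "a + Suc l * d < N"
      and mono: "\<And>k. k \<in> {1..Suc l} \<Longrightarrow> c (a + k * d) = c (a + d)"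
      unfolding monochromatic_ap_def by blast
    let ?x = "c (a + d)" and ?j = "a + d"
    have mem: "?x + (s + multiple (?j + k * d) t) \<in> A" if "k \<le> l" for k
    proof -
      have "Suc k * d \<le> Suc l * d" using that by (intro mult_le_mono1) simp
      moreover have "d \<le> Suc k * d" by simp
      ultimately have "a + Suc k * d \<in> {1..<N}"
        using bound d unfolding atLeastLessThan_iff by linarith
      then show ?thesis using c[of "a + Suc k * d"] mono[of "Suc k"] that by (simp add: add.assoc)
    qed
    \<comment> \<open>Splitting the multiple requires \<open>k \<ge> 1\<close>, so
      \<open>k = 0\<close> is treated separately.\<close>
    have "?x + s + multiple ?j t + multiple (k * d) t \<in> A" if "k \<in> {1..l}" for k
    proof -
      have "multiple (?j + k * d) t = multiple ?j t + multiple (k * d) t"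
        using that d by (intro multiple_add) auto
      then show ?thesis using mem[of k] that by (simp add: add.assoc)
    qed
    moreover have "?x + s + multiple ?j t \<in> A" using mem[of 0] by (simp add: add.assoc)
    ultimately have "(s, t) \<in> Q (?x, ?j, d)" by (simp add: Q_def B_def image_subset_iff)
    moreover have "?j \<in> {1..<N}" "d \<in> {1..<N}" using d bound by auto
    ultimately show ?thesis using cF by blast
  qed
  then have "{(s, t). \<forall>j\<in>{1..<N}. s + multiple j t \<in> T} \<subseteq> (\<Union>i\<in>F \<times> {1..<N} \<times> {1..<N}. Q i)"
    by blast
  moreover have "piecewise_syndetic {(s, t). \<forall>j\<in>{1..<N}. s + multiple j t \<in> T}"
    unfolding T_def by (intro thick_imp_piecewise_syndetic thick_progressions thick)
  ultimately have "piecewise_syndetic (\<Union>i\<in>F \<times> {1..<N} \<times> {1..<N}. Q i)"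
    by (rule piecewise_syndetic_mono[rotated])
  then have "\<exists>i\<in>F \<times> {1..<N} \<times> {1..<N}. piecewise_syndetic (Q i)"
    using F by (intro piecewise_syndetic_UN) auto
  then obtain x j d where "j \<ge> 1" "d \<ge> 1" and ps: "piecewise_syndetic (Q (x, j, d))"
    by force
  have "piecewise_syndetic (B d)"
    using ps unfolding Q_def prod.case by (rule piecewise_syndetic_shear[OF \<open>j \<ge> 1\<close>])
  then show ?thesis using \<open>d \<ge> 1\<close> unfolding B_def by blast
qed

end
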